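(* There exist directed graphs $G=(V,E)$ with positive real edge capacities, a designated source vertex $s$ and a designated sink vertex $t$, on $n=|V|$ vertices, with a subset $E'\subseteq E$ of $\Omega(n^2)$ edges such that for every two distinct edges $e,e'\in E'$, the capacity of a mincut for $e$ differs from the capacity of a mincut for $e'$.
   Context: An $(s,t)$-cut is a set $C\subset V$ with $s\in C$, $t\notin C$; an edge $(x,y)$ contributes to $C$ if $x\in C$, $y\notin C$; $c(C)$ is the total capacity of contributing edges. A mincut for edge $e$ is an $(s,t)$-cut to which $e$ contributes of minimum capacity among all $(s,t)$-cuts to which $e$ contributes. *)

theory Defs
  imports "Graph_Theory.Pair_Digraph" "HOL-Library.Landau_Symbols" Complex_Main
begin

definition st_cut :: "'a pair_pre_digraph \<Rightarrow> 'a \<Rightarrow> 'a \<Rightarrow> 'a set \<Rightarrow> bool" where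
  "st_cut G s t C \<longleftrightarrow> C \<subseteq> pverts G \<and> s \<in> C \<and> t \<notin> C"

definition contributes :: "'a \<times> 'a \<Rightarrow> 'a set \<Rightarrow> bool" where
  "contributes e C \<longleftrightarrow> fst e \<in> C \<and> snd e \<notin> C"

definition cut_capacity :: "'a pair_pre_digraph \<Rightarrow> ('a \<times> 'a \<Rightarrow> real) \<Rightarrow> 'a set \<Rightarrow> real" where
  "cut_capacity G cap C = (\<Sum>e \<in> {e \<in> parcs G. contributes e C}. cap e)"

definition mincut_for_edge ::
  "'a pair_pre_digraph \<Rightarrow> ('a \<times> 'a \<Rightarrow> real) \<Rightarrow> 'a \<Rightarrow> 'a \<Rightarrow> 'a \<times> 'a \<Rightarrow> 'a set \<Rightarrow> bool" where
  "mincut_for_edge G cap s t e C \<longleftrightarrow>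
     st_cut G s t C \<and> contributes e C \<and>
     (\<forall>D. st_cut G s t D \<and> contributes e D \<longrightarrow> cut_capacity G cap C \<le> cut_capacity G cap D)"

end

theory Submission
  imports Defs
begin

text \<open>
  Let every \<open>a \<in> A\<close> have an arc to the sink, every \<open>b \<in> B\<close> an arc from the source, and join
  \<open>A\<close> completely to \<open>B\<close>. A cut to which \<open>(a, b)\<close> contributes is also charged for \<open>(a, t)\<close> and
  \<open>(s, b)\<close>, and the cut \<open>{s, a} \<union> (B - {b})\<close> is charged for nothing else. So the mincut for
  \<open>(a, b)\<close> has capacity \<open>c(a, t) + c(s, b) + c(a, b)\<close>, and it suffices to choose the terminal
  capacities such that these sums are pairwise distinct, which base-\<open>n\<close> digits achieve.
\<close>

text \<open>The source is \<open>0\<close>, the sink is \<open>1\<close>, and about half of the other vertices lie in each of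
  \<open>A\<close> and \<open>B\<close>.\<close>

definition A_side :: "nat \<Rightarrow> nat set" where
  "A_side n = {2..<n div 2 + 1}"

definition B_side :: "nat \<Rightarrow> nat set" where
  "B_side n = {n div 2 + 1..<n}"

definition bip_arcs :: "nat \<Rightarrow> (nat \<times> nat) set" where
  "bip_arcs n = A_side n \<times> {1} \<union> {0} \<times> B_side n \<union> A_side n \<times> B_side n"

definition bip_graph :: "nat \<Rightarrow> nat pair_pre_digraph" where
  "bip_graph n = \<lparr>pverts = {..<n}, parcs = bip_arcs n\<rparr>"

text \<open>An arc into the sink carries the low base-\<open>n\<close> digit, its tail; an arc out
  of the source carries its head as the high digit. The constant 1 on middle arcs shifts all sums
  alike.\<close>

definition bip_cap :: "nat \<Rightarrow> nat \<times> nat \<Rightarrow> real" where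
  "bip_cap n e = (if fst e = 0 then real (n * snd e) else if snd e = 1 then real (fst e) else 1)"

lemma A_sideD: "a \<in> A_side n \<Longrightarrow> 2 \<le> a \<and> a < n \<and> a \<notin> B_side n"
  by (auto simp: A_side_def B_side_def)

lemma B_sideD: "n \<ge> 2 \<Longrightarrow> b \<in> B_side n \<Longrightarrow> 2 \<le> b \<and> b < n"
  by (auto simp: B_side_def)

lemma finite_bip_arcs: "finite (bip_arcs n)"
  by (simp add: bip_arcs_def A_side_def B_side_def)

lemma pair_digraph_bip_graph:
  assumes "n \<ge> 2"
  shows "pair_digraph (bip_graph n)"
proof
  show "finite (pverts (bip_graph n))" "finite (parcs (bip_graph n))"
    by (simp_all add: bip_graph_def finite_bip_arcs)
  fix e assume "e \<in> parcs (bip_graph n)"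
  then show "fst e \<in> pverts (bip_graph n)" "snd e \<in> pverts (bip_graph n)" "fst e \<noteq> snd e"
    using assms by (auto simp: bip_graph_def bip_arcs_def A_side_def B_side_def)
qed

lemma bip_cap_pos: "n \<ge> 2 \<Longrightarrow> e \<in> parcs (bip_graph n) \<Longrightarrow> 0 < bip_cap n e"
  by (auto simp: bip_graph_def bip_arcs_def bip_cap_def A_side_def B_side_def)

definition edge_cut :: "nat \<Rightarrow> nat \<times> nat \<Rightarrow> nat set" where
  "edge_cut n e = insert 0 (insert (fst e) (B_side n - {snd e}))"

text \<open>Since \<open>a\<close> and \<open>b\<close> are at least 2, the three arcs are distinct
  and none is lost from the sum over the set. The value serves both the upper and the lower
  bound.\<close>

lemma sum_bip_cap_forced_arcs:
  assumes "n \<ge> 2" "a \<in> A_side n" "b \<in> B_side n"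
  shows "(\<Sum>e\<in>{(a, 1), (0, b), (a, b)}. bip_cap n e) = real (a + n * b + 1)"
  using A_sideD[OF assms(2)] B_sideD[OF assms(1,3)] by (simp add: bip_cap_def)

lemma st_cut_edge_cut:
  assumes "n \<ge> 2" "a \<in> A_side n" "b \<in> B_side n"
  shows "st_cut (bip_graph n) 0 1 (edge_cut n (a, b))"
  using assms by (auto simp: st_cut_def bip_graph_def edge_cut_def A_side_def B_side_def)

lemma contributes_edge_cut:
  assumes "n \<ge> 2" "a \<in> A_side n" "b \<in> B_side n"
  shows "contributes (a, b) (edge_cut n (a, b))"
  using A_sideD[OF assms(2)] B_sideD[OF assms(1,3)] assms(2,3)
  by (auto simp: contributes_def edge_cut_def)

lemma cut_capacity_edge_cut:
  assumes "n \<ge> 2" "a \<in> A_side n" "b \<in> B_side n"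
  shows "cut_capacity (bip_graph n) (bip_cap n) (edge_cut n (a, b)) = real (a + n * b + 1)"
proof -
  \<comment> \<open>No arc leaves \<open>B_side n\<close>. Arcs from 0 end in
    \<open>B_side n\<close>, where only \<open>b\<close> is outside the cut; arcs from
    \<open>a\<close> end there or at 1.\<close>
  have "{e \<in> parcs (bip_graph n). contributes e (edge_cut n (a, b))} = {(a, 1), (0, b), (a, b)}"
    using assms
    by (auto simp: bip_graph_def bip_arcs_def contributes_def edge_cut_def A_side_def B_side_def)
  then show ?thesis
    using sum_bip_cap_forced_arcs[OF assms] by (simp only: cut_capacity_def)
qed

text \<open>As 0 and \<open>a\<close> lie in \<open>D\<close> while 1 and \<open>b\<close> do not,
  all three arcs contribute to \<open>D\<close>; any further contributing arcs have positive
  capacity.\<close>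

lemma cut_capacity_ge:
  assumes "n \<ge> 2" "a \<in> A_side n" "b \<in> B_side n"
    and D: "st_cut (bip_graph n) 0 1 D" "contributes (a, b) D"
  shows "real (a + n * b + 1) \<le> cut_capacity (bip_graph n) (bip_cap n) D"
proof -
  have "(\<Sum>e\<in>{(a, 1), (0, b), (a, b)}. bip_cap n e) \<le> cut_capacity (bip_graph n) (bip_cap n) D"
    unfolding cut_capacity_def
  proof (rule sum_mono2)
    show "finite {e \<in> parcs (bip_graph n). contributes e D}"
      by (simp add: bip_graph_def finite_bip_arcs)
    show "{(a, 1), (0, b), (a, b)} \<subseteq> {e \<in> parcs (bip_graph n). contributes e D}"
      using assms by (auto simp: bip_graph_def bip_arcs_def contributes_def st_cut_def)
  qed (auto intro: less_imp_le bip_cap_pos[OF assms(1)])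
  then show ?thesis
    using sum_bip_cap_forced_arcs[OF assms(1-3)] by simp
qed

lemma mincut_edge_cut:
  assumes "n \<ge> 2" "a \<in> A_side n" "b \<in> B_side n"
  shows "mincut_for_edge (bip_graph n) (bip_cap n) 0 1 (a, b) (edge_cut n (a, b))"
  unfolding mincut_for_edge_def cut_capacity_edge_cut[OF assms]
  using st_cut_edge_cut contributes_edge_cut cut_capacity_ge assms by blast

text \<open>Any two mincuts for the same edge bound each other's capacity, so the value found for
  \<open>edge_cut\<close> holds for every mincut.\<close>

lemma mincut_capacity:
  assumes "n \<ge> 2" "a \<in> A_side n" "b \<in> B_side n"
    and "mincut_for_edge (bip_graph n) (bip_cap n) 0 1 (a, b) C"
  shows "cut_capacity (bip_graph n) (bip_cap n) C = real (a + n * b + 1)"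
  using mincut_edge_cut[OF assms(1-3)] assms(4) cut_capacity_edge_cut[OF assms(1-3)]
  unfolding mincut_for_edge_def by (metis order_antisym)

text \<open>Division by \<open>n\<close> with remainder recovers both digits.\<close>

lemma digits_inject:
  fixes a a' b b' n :: nat
  assumes "a + n * b = a' + n * b'" "a < n" "a' < n"
  shows "a = a' \<and> b = b'"
proof -
  have "a = (a + n * b) mod n" "b = (a + n * b) div n"
    "a' = (a' + n * b') mod n" "b' = (a' + n * b') div n"
    using assms(2,3) by auto
  then show ?thesis
    using assms(1) by metis
qed

lemma mincut_capacities_distinct:
  assumes "n \<ge> 2" "e \<in> A_side n \<times> B_side n" "e' \<in> A_side n \<times> B_side n" "e \<noteq> e'"
    and "mincut_for_edge (bip_graph n) (bip_cap n) 0 1 e C"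
    and "mincut_for_edge (bip_graph n) (bip_cap n) 0 1 e' C'"
  shows "cut_capacity (bip_graph n) (bip_cap n) C \<noteq> cut_capacity (bip_graph n) (bip_cap n) C'"
proof
  assume eq: "cut_capacity (bip_graph n) (bip_cap n) C = cut_capacity (bip_graph n) (bip_cap n) C'"
  obtain a b a' b' where e: "e = (a, b)" "e' = (a', b')"
    by (cases e, cases e')
  have "real (a + n * b + 1) = real (a' + n * b' + 1)"
    using eq mincut_capacity[of n a b C] mincut_capacity[of n a' b' C'] assms e by auto
  then have "a + n * b = a' + n * b'"
    by linarith
  then show False
    using digits_inject[of a n b a' b'] assms e A_sideD by blast
qed

text \<open>Each side eventually has at least \<open>n / 4\<close> vertices, whence the constant
  1/16.\<close>

lemma card_sides_bigomega: "(\<lambda>n. real (card (A_side n \<times> B_side n))) \<in> \<Omega>(\<lambda>n. real n ^ 2)"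
proof (rule landau_omega.bigI)
  show "(1 / 16 :: real) > 0" by simp
  show "eventually (\<lambda>n. norm (real (card (A_side n \<times> B_side n))) \<ge> 1 / 16 * norm (real n ^ 2))
    at_top"
    \<comment> \<open>\<open>A_side n\<close> has \<open>n div 2 - 1\<close> elements, which is
      below \<open>n / 4\<close> at \<open>n = 5\<close> but never from 6 on.\<close>
    using eventually_ge_at_top[of 6]
  proof eventually_elim
    case (elim n)
    have "real n / 4 \<le> real (card (A_side n))" "real n / 4 \<le> real (card (B_side n))"
      using elim by (auto simp: A_side_def B_side_def; linarith)+
    then have "(real n / 4) * (real n / 4) \<le> real (card (A_side n)) * real (card (B_side n))"
      by (intro mult_mono) auto
    then show ?case
      by (simp add: card_cartesian_product power2_eq_square)
  qed
qed

theorem theorem13: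
  shows "\<exists>(G :: nat \<Rightarrow> nat pair_pre_digraph) (cap :: nat \<Rightarrow> nat \<times> nat \<Rightarrow> real)
      (s :: nat \<Rightarrow> nat) (t :: nat \<Rightarrow> nat) (E' :: nat \<Rightarrow> (nat \<times> nat) set).
    (\<forall>n\<ge>2. pair_digraph (G n) \<and> card (pverts (G n)) = n \<and>
       (\<forall>e \<in> parcs (G n). 0 < cap n e) \<and>
       s n \<in> pverts (G n) \<and> t n \<in> pverts (G n) \<and> s n \<noteq> t n \<and>
       E' n \<subseteq> parcs (G n) \<and>
       (\<forall>e \<in> E' n. \<exists>C. mincut_for_edge (G n) (cap n) (s n) (t n) e C) \<and>
       (\<forall>e \<in> E' n. \<forall>e' \<in> E' n. e \<noteq> e' \<longrightarrow>
          (\<forall>C C'. mincut_for_edge (G n) (cap n) (s n) (t n) e C \<and>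
                  mincut_for_edge (G n) (cap n) (s n) (t n) e' C' \<longrightarrow>
                  cut_capacity (G n) (cap n) C \<noteq> cut_capacity (G n) (cap n) C'))) \<and>
    (\<lambda>n. real (card (E' n))) \<in> \<Omega>(\<lambda>n. real n ^ 2)"
proof (intro exI conjI allI impI)
  show "(\<lambda>n. real (card (A_side n \<times> B_side n))) \<in> \<Omega>(\<lambda>n. real n ^ 2)"
    by (rule card_sides_bigomega)
  fix n :: nat assume n: "n \<ge> 2"
  show "pair_digraph (bip_graph n)"
    by (rule pair_digraph_bip_graph[OF n])
  show "card (pverts (bip_graph n)) = n" "0 \<in> pverts (bip_graph n)" "1 \<in> pverts (bip_graph n)"
    using n by (simp_all add: bip_graph_def)
  show "(0::nat) \<noteq> 1" by simp
  show "\<forall>e \<in> parcs (bip_graph n). 0 < bip_cap n e"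
    using bip_cap_pos[OF n] by blast
  show "A_side n \<times> B_side n \<subseteq> parcs (bip_graph n)"
    by (auto simp: bip_graph_def bip_arcs_def)
  show "\<forall>e \<in> A_side n \<times> B_side n. \<exists>C. mincut_for_edge (bip_graph n) (bip_cap n) 0 1 e C"
    using mincut_edge_cut[OF n] by auto
  show "\<forall>e \<in> A_side n \<times> B_side n. \<forall>e' \<in> A_side n \<times> B_side n. e \<noteq> e' \<longrightarrow>
      (\<forall>C C'. mincut_for_edge (bip_graph n) (bip_cap n) 0 1 e C \<and>
              mincut_for_edge (bip_graph n) (bip_cap n) 0 1 e' C' \<longrightarrow>
        cut_capacity (bip_graph n) (bip_cap n) C \<noteq> cut_capacity (bip_graph n) (bip_cap n) C')"
    using mincut_capacities_distinct[OF n] by blast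
qed

end
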